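(* Let $K$ be an infinite field and let $n,t$ be integers with $1\le t\le \frac{n(n-1)}{2}$. Then a generic Lie algebra $L\in\mathfrak N_2^K(n,t)$ satisfies the following: $\dim Z(L)=2$ if $t=1$ and $n$ is odd, and $Z(L)=[L,L]$ otherwise. Here $Z(L)$ denotes the center of $L$.
   Context: $\mathfrak N_2^K(n,t)$ is the set of all 2-step nilpotent Lie algebras $L$ over $K$ with $\dim L/[L,L]=n$ and $\dim [L,L]=t$. Let $V$ be an $n$-dimensional $K$-vector space, $B_n=B_n(K)$ the space of alternating bilinear forms on $V$, and $S$ a $t$-dimensional vector space with basis $z_1,\dots,z_t$. For a $t$-tuple $\Phi=(\varphi_1,\dots,\varphi_t)\in B_n^t$, $L(\Phi)=V\oplus S$ is the Lie algebra with bracket $[\bar x+\bar{\bar x},\bar y+\bar{\bar y}]=\sum_{i=1}^t\varphi_i(\bar x,\bar y)z_i$ ($\bar x,\bar y\in V$, $\bar{\bar x},\bar{\bar y}\in S$). Let $\mathbb P(B_n^t)$ be the projective space of the vector space $B_n^t$ (the $t$-th direct power), with the Zariski topology, and let $M_{n,t}\subset\mathbb P(B_n^t)$ be the Zariski-open subset of points $(\varphi_1:\dots:\varphi_t)$ with $\varphi_1,\dots,\varphi_t$ linearly independent. To a point of $M_{n,t}$ corresponds the Lie algebra $L(\Phi)\in\mathfrak N_2^K(n,t)$ (well defined up to isomorphism; every algebra of $\mathfrak N_2^K(n,t)$ arises this way up to isomorphism). Generic: a generic Lie algebra of $\mathfrak N_2^K(n,t)$ has an (isomorphism-invariant) property $\mathcal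 A$ if the set of points of $M_{n,t}$ corresponding to algebras without property $\mathcal A$ is contained in some proper Zariski-closed subset of $M_{n,t}$. *)

theory Defs
  imports "HOL-Analysis.Analysis" "HOL-Library.Function_Algebras"
begin

section \<open>Lie algebras\<close>

locale lie_algebra = vector_space scale
  for scale :: "'k::field \<Rightarrow> 'l::ab_group_add \<Rightarrow> 'l" +
  fixes bracket :: "'l \<Rightarrow> 'l \<Rightarrow> 'l"
  assumes bracket_add_left: "bracket (x + y) z = bracket x z + bracket y z"
    and bracket_add_right: "bracket x (y + z) = bracket x y + bracket x z"
    and bracket_scale_left: "bracket (scale c x) y = scale c (bracket x y)"
    and bracket_scale_right: "bracket x (scale c y) = scale c (bracket x y)"
    and bracket_self: "bracket x x = 0"
    and jacobi: "bracket x (bracket y z) + bracket y (bracket z x) + bracket z (bracket x y) = 0"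

definition lie_center :: "('l \<Rightarrow> 'l \<Rightarrow> 'l::ab_group_add) \<Rightarrow> 'l set" where
  "lie_center br = {x. \<forall>y. br x y = 0}"

definition lie_derived ::
  "('k::field \<Rightarrow> 'l::ab_group_add \<Rightarrow> 'l) \<Rightarrow> ('l \<Rightarrow> 'l \<Rightarrow> 'l) \<Rightarrow> 'l set" where
  "lie_derived s br = module.span s {br x y | x y. True}"

(* The set B below represents a basis of the quotient of the whole space by D. *)
definition has_codim ::
  "('k::field \<Rightarrow> 'l::ab_group_add \<Rightarrow> 'l) \<Rightarrow> 'l set \<Rightarrow> nat \<Rightarrow> bool" where
  "has_codim s D n \<longleftrightarrow>
     (\<exists>B. finite B \<and> card B = n \<and> \<not> module.dependent s B \<and>
          module.span s B \<inter> D = {0} \<and> module.span s (B \<union> D) = UNIV)"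

definition two_step_nilpotent_type ::
  "nat \<Rightarrow> nat \<Rightarrow> ('k::field \<Rightarrow> 'l::ab_group_add \<Rightarrow> 'l) \<Rightarrow> ('l \<Rightarrow> 'l \<Rightarrow> 'l) \<Rightarrow> bool" where
  "two_step_nilpotent_type n t s br \<longleftrightarrow>
     lie_algebra s br \<and>
     lie_derived s br \<noteq> {0} \<and>
     (\<forall>x. \<forall>y \<in> lie_derived s br. br x y = 0) \<and>
     has_codim s (lie_derived s br) n \<and>
     vector_space.dim s (lie_derived s br) = t"


section \<open>Zariski-closed subsets of projective spaces\<close>

text \<open>Throughout, \<open>W\<close> is a finite-dimensional subspace of the vector space with scalar
  multiplication \<open>s\<close>; the points of the projective space of \<open>W\<close> are the lines in \<open>W\<close>.\<close>

definition proj_space :: "('k::field \<Rightarrow> 'w::ab_group_add \<Rightarrow> 'w) \<Rightarrow> 'w set \<Rightarrow> 'w set set" where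
  "proj_space s W = {module.span s {w} | w. w \<in> W \<and> w \<noteq> 0}"

definition linear_functional_on ::
  "('k::field \<Rightarrow> 'w::ab_group_add \<Rightarrow> 'w) \<Rightarrow> 'w set \<Rightarrow> ('w \<Rightarrow> 'k) \<Rightarrow> bool" where
  "linear_functional_on s W f \<longleftrightarrow>
     (\<forall>u\<in>W. \<forall>v\<in>W. f (u + v) = f u + f v) \<and> (\<forall>c. \<forall>w\<in>W. f (s c w) = c * f w)"

text \<open>Functions that are on \<open>W\<close> given by a homogeneous polynomial of degree \<open>d\<close> in linear
  coordinates of \<open>W\<close>; the values outside \<open>W\<close> are irrelevant.\<close>

inductive homogeneous_poly_fun ::
  "('k::field \<Rightarrow> 'w::ab_group_add \<Rightarrow> 'w) \<Rightarrow> 'w set \<Rightarrow> nat \<Rightarrow> ('w \<Rightarrow> 'k) \<Rightarrow> bool"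
  for s :: "'k::field \<Rightarrow> 'w::ab_group_add \<Rightarrow> 'w" and W :: "'w set" where
  const: "homogeneous_poly_fun s W 0 (\<lambda>_. c)"
| linear: "linear_functional_on s W f \<Longrightarrow> homogeneous_poly_fun s W 1 f"
| add: "homogeneous_poly_fun s W d f \<Longrightarrow> homogeneous_poly_fun s W d g \<Longrightarrow>
    homogeneous_poly_fun s W d (\<lambda>w. f w + g w)"
| mult: "homogeneous_poly_fun s W d f \<Longrightarrow> homogeneous_poly_fun s W e g \<Longrightarrow>
    homogeneous_poly_fun s W (d + e) (\<lambda>w. f w * g w)"

definition zariski_closed ::
  "('k::field \<Rightarrow> 'w::ab_group_add \<Rightarrow> 'w) \<Rightarrow> 'w set \<Rightarrow> 'w set set \<Rightarrow> bool" where
  "zariski_closed s W C \<longleftrightarrow>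
     (\<exists>F. (\<forall>f\<in>F. \<exists>d. homogeneous_poly_fun s W d f) \<and>
          C = {p \<in> proj_space s W. \<forall>f\<in>F. \<forall>w\<in>p. f w = 0})"

definition zariski_closed_in ::
  "('k::field \<Rightarrow> 'w::ab_group_add \<Rightarrow> 'w) \<Rightarrow> 'w set \<Rightarrow> 'w set set \<Rightarrow> 'w set set \<Rightarrow> bool" where
  "zariski_closed_in s W M D \<longleftrightarrow> (\<exists>C. zariski_closed s W C \<and> D = M \<inter> C)"


section \<open>Tuples of alternating bilinear forms and their Lie algebras\<close>

type_synonym ('k, 'n) form = "'k^'n \<Rightarrow> 'k^'n \<Rightarrow> 'k"
type_synonym ('k, 'n, 't) form_tuple = "'t \<Rightarrow> ('k, 'n) form"

definition alternating_forms :: "('k::field, 'n::finite) form set" where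
  "alternating_forms =
     {\<phi>. (\<forall>x y z. \<phi> (x + y) z = \<phi> x z + \<phi> y z) \<and>
         (\<forall>x y z. \<phi> x (y + z) = \<phi> x y + \<phi> x z) \<and>
         (\<forall>c x y. \<phi> (c *s x) y = c * \<phi> x y) \<and>
         (\<forall>c x y. \<phi> x (c *s y) = c * \<phi> x y) \<and>
         (\<forall>x. \<phi> x x = 0)}"

definition alternating_tuples :: "('k::field, 'n::finite, 't::finite) form_tuple set" where
  "alternating_tuples = {\<Phi>. \<forall>i. \<Phi> i \<in> alternating_forms}"

definition tuple_scale ::
  "'k::field \<Rightarrow> ('k, 'n::finite, 't::finite) form_tuple \<Rightarrow> ('k, 'n, 't) form_tuple" where
  "tuple_scale c \<Phi> = (\<lambda>i x y. c * \<Phi> i x y)"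

definition lin_indep_tuple :: "('k::field, 'n::finite, 't::finite) form_tuple \<Rightarrow> bool" where
  "lin_indep_tuple \<Phi> \<longleftrightarrow>
     (\<forall>c. (\<forall>x y. (\<Sum>i\<in>UNIV. c i * \<Phi> i x y) = 0) \<longrightarrow> (\<forall>i. c i = 0))"

definition M_points :: "('k::field, 'n::finite, 't::finite) form_tuple set set" where
  "M_points = {p \<in> proj_space tuple_scale alternating_tuples. \<forall>\<Phi>\<in>p - {0}. lin_indep_tuple \<Phi>}"

type_synonym ('k, 'n, 't) L_space = "('k^'n) \<times> ('k^'t)"

definition L_scale ::
  "'k::field \<Rightarrow> ('k, 'n::finite, 't::finite) L_space \<Rightarrow> ('k, 'n, 't) L_space" where
  "L_scale c u = (c *s fst u, c *s snd u)"

definition L_bracket ::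
  "('k::field, 'n::finite, 't::finite) form_tuple \<Rightarrow>
     ('k, 'n, 't) L_space \<Rightarrow> ('k, 'n, 't) L_space \<Rightarrow> ('k, 'n, 't) L_space" where
  "L_bracket \<Phi> u v = (0, \<Sum>i\<in>UNIV. \<Phi> i (fst u) (fst v) *s axis i 1)"

text \<open>Here \<open>A\<close> is a property of Lie algebras, given by their scalar multiplication and bracket,
  on the space underlying the algebras \<open>L(\<Phi>)\<close>.  For isomorphism-invariant \<open>A\<close> the choice
  of the representative \<open>\<Phi>\<close> of \<open>p\<close> does not matter.\<close>

definition generic_two_step ::
  "(('k::field \<Rightarrow> ('k, 'n::finite, 't::finite) L_space \<Rightarrow> ('k, 'n, 't) L_space) \<Rightarrow>
    (('k, 'n, 't) L_space \<Rightarrow> ('k, 'n, 't) L_space \<Rightarrow> ('k, 'n, 't) L_space) \<Rightarrow> bool) \<Rightarrow> bool" where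
  "generic_two_step A \<longleftrightarrow>
     (\<exists>D :: ('k, 'n, 't) form_tuple set set.
        zariski_closed_in tuple_scale alternating_tuples M_points D \<and> D \<noteq> M_points \<and>
        {p \<in> M_points. \<exists>\<Phi>\<in>p - {0}. \<not> A L_scale (L_bracket \<Phi>)} \<subseteq> D)"


section \<open>The algebras \<open>L(\<Phi>)\<close> are 2-step nilpotent of the right type\<close>

lemma L_scale_vector_space:
  "vector_space (L_scale :: 'k::field \<Rightarrow> ('k, 'n::finite, 't::finite) L_space \<Rightarrow> _)"
  by unfold_locales
    (auto simp: L_scale_def vec.scale_right_distrib vec.scale_left_distrib)

lemma L_bracket_snd:
  "L_bracket \<Phi> u v = (0, \<chi> i. \<Phi> i (fst u) (fst v))"
  by (simp add: L_bracket_def vec_eq_iff axis_def if_distrib sum.If_cases cong: if_cong)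

lemma alternating_formsD:
  assumes "\<phi> \<in> alternating_forms"
  shows "\<phi> (x + y) z = \<phi> x z + \<phi> y z" "\<phi> x (y + z) = \<phi> x y + \<phi> x z"
    "\<phi> (c *s x) y = c * \<phi> x y" "\<phi> x (c *s y) = c * \<phi> x y" "\<phi> x x = 0" "\<phi> x 0 = 0" "\<phi> 0 x = 0"
proof -
  show *: "\<phi> (x + y) z = \<phi> x z + \<phi> y z" "\<phi> x (y + z) = \<phi> x y + \<phi> x z"
    "\<phi> (c *s x) y = c * \<phi> x y" "\<phi> x (c *s y) = c * \<phi> x y" "\<phi> x x = 0" for x y z c
    using assms by (auto simp: alternating_forms_def)
  show "\<phi> x 0 = 0" using *(4)[of x 0 0] by simp
  show "\<phi> 0 x = 0" using *(3)[of 0 0 x] by simp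
qed

lemma L_lie_algebra:
  fixes \<Phi> :: "('k::field, 'n::finite, 't::finite) form_tuple"
  assumes "\<Phi> \<in> alternating_tuples"
  shows "lie_algebra L_scale (L_bracket \<Phi>)"
proof -
  interpret vector_space "L_scale :: 'k \<Rightarrow> ('k, 'n, 't) L_space \<Rightarrow> _" by (rule L_scale_vector_space)
  have "\<Phi> i \<in> alternating_forms" for i using assms by (simp add: alternating_tuples_def)
  note * = alternating_formsD[OF this]
  show ?thesis
    by unfold_locales (auto simp: L_bracket_snd L_scale_def vec_eq_iff * zero_prod_def)
qed

lemma L_derived:
  fixes \<Phi> :: "('k::field, 'n::finite, 't::finite) form_tuple"
  assumes "lin_indep_tuple \<Phi>"
  shows "lie_derived L_scale (L_bracket \<Phi>) = {0} \<times> UNIV"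
proof -
  interpret L: vector_space "L_scale :: 'k \<Rightarrow> ('k, 'n, 't) L_space \<Rightarrow> _" by (rule L_scale_vector_space)
  interpret K: vector_space "(*) :: 'k \<Rightarrow> 'k \<Rightarrow> 'k" by unfold_locales (auto simp: algebra_simps)
  interpret P: vector_space_pair "(*s) :: 'k \<Rightarrow> 'k^'t \<Rightarrow> _" "(*) :: 'k \<Rightarrow> 'k \<Rightarrow> 'k" ..
  interpret Q: vector_space_pair "(*s) :: 'k \<Rightarrow> 'k^'t \<Rightarrow> _" "L_scale :: 'k \<Rightarrow> ('k, 'n, 't) L_space \<Rightarrow> _" ..
  define S where "S = {(\<chi> i. \<Phi> i x y) | x y. True}"
  have "vec.span S = UNIV"
  proof (rule ccontr)
    assume "vec.span S \<noteq> UNIV"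
    then obtain y where y: "y \<notin> vec.span S" by blast
    obtain B where B: "B \<subseteq> S" "vec.independent B" "vec.span B = vec.span S"
      using vec.basis_exists[of S] vec.span_mono vec.span_span
      by (metis subset_antisym)
    have "vec.independent (insert y B)"
      using B y by (simp add: vec.independent_insertI)
    from P.linear_independent_extend[OF this, of "\<lambda>b. if b = y then 1 else 0"]
    obtain f where f: "Vector_Spaces.linear (*s) (*) f"
      "\<forall>b\<in>insert y B. f b = (if b = y then 1 else 0)" by blast
    have yB: "y \<notin> B" using y B vec.span_base by blast
    have f0: "f x = 0" if "x \<in> vec.span S" for x
      by (rule P.linear_eq_0_on_span[OF f(1), of B]) (use that f(2) yB B(3) in auto)
    have fx: "f x = (\<Sum>i\<in>UNIV. f (axis i 1) * x $ i)" for x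
    proof -
      have "f x = f (\<Sum>i\<in>UNIV. x $ i *s axis i 1)" by (simp add: basis_expansion)
      also have "\<dots> = (\<Sum>i\<in>UNIV. x $ i * f (axis i 1))"
        by (simp add: P.linear_sum[OF f(1)] P.linear_scale[OF f(1)])
      finally show ?thesis by (simp add: mult.commute)
    qed
    have "(\<Sum>i\<in>UNIV. f (axis i 1) * \<Phi> i x z) = 0" for x z
    proof -
      have "(\<chi> i. \<Phi> i x z) \<in> vec.span S" by (rule vec.span_base) (auto simp: S_def)
      from f0[OF this] show ?thesis by (subst (asm) fx) simp
    qed
    then have "f (axis i 1) = 0" for i
      using assms unfolding lin_indep_tuple_def
      by (elim allE[of _ "\<lambda>i. f (axis i 1)"]) simp
    then have "f y = 0" by (subst fx) simp
    then show False using f(2) by simp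
  qed
  moreover have "lie_derived L_scale (L_bracket \<Phi>) = L.span (Pair 0 ` S)"
  proof -
    have "{L_bracket \<Phi> x y | x y. True} = Pair 0 ` S"
      by (fastforce simp: L_bracket_snd S_def)
    then show ?thesis by (simp add: lie_derived_def)
  qed
  moreover have "Vector_Spaces.linear (*s) L_scale (Pair 0 :: 'k^'t \<Rightarrow> ('k, 'n, 't) L_space)"
    by unfold_locales (auto simp: L_scale_def)
  ultimately show ?thesis
    using Q.linear_span_image by fastforce
qed

lemma L_two_step_nilpotent_type:
  fixes p :: "('k::field, 'n::finite, 't::finite) form_tuple set"
  assumes "p \<in> M_points" "\<Phi> \<in> p - {0}"
  shows "two_step_nilpotent_type CARD('n) CARD('t) L_scale (L_bracket \<Phi>)"
proof -
  interpret L: vector_space "L_scale :: 'k \<Rightarrow> ('k, 'n, 't) L_space \<Rightarrow> _" by (rule L_scale_vector_space)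
  interpret T: vector_space "tuple_scale :: 'k \<Rightarrow> ('k, 'n, 't) form_tuple \<Rightarrow> _"
    by unfold_locales (auto simp: tuple_scale_def fun_eq_iff algebra_simps)
  interpret Q: vector_space_pair "(*s) :: 'k \<Rightarrow> 'k^'t \<Rightarrow> _" "L_scale :: 'k \<Rightarrow> ('k, 'n, 't) L_space \<Rightarrow> _" ..
  interpret R: vector_space_pair "(*s) :: 'k \<Rightarrow> 'k^'n \<Rightarrow> _" "L_scale :: 'k \<Rightarrow> ('k, 'n, 't) L_space \<Rightarrow> _" ..
  have indep: "lin_indep_tuple \<Phi>" using assms by (auto simp: M_points_def)
  have alt: "\<Phi> \<in> alternating_tuples"
    using assms
    by (auto simp: M_points_def proj_space_def T.span_singleton tuple_scale_def
        alternating_tuples_def alternating_forms_def algebra_simps)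
  have "\<Phi> i \<in> alternating_forms" for i using alt by (simp add: alternating_tuples_def)
  note bil = alternating_formsD[OF this]
  let ?Z = "{0} \<times> UNIV :: ('k, 'n, 't) L_space set"
  have linS: "Vector_Spaces.linear (*s) L_scale (Pair 0 :: 'k^'t \<Rightarrow> ('k, 'n, 't) L_space)"
    by unfold_locales (auto simp: L_scale_def)
  have linV: "Vector_Spaces.linear (*s) L_scale (\<lambda>x :: 'k^'n. (x, 0 :: 'k^'t))"
    by unfold_locales (auto simp: L_scale_def)
  have Z: "Pair 0 ` (UNIV :: ('k^'t) set) = ?Z" by auto
  have dimZ: "L.dim ?Z = CARD('t)"
  proof -
    have b: "L.independent (Pair 0 ` cart_basis :: ('k, 'n, 't) L_space set)"
      using Q.linear_independent_injective_image[OF linS independent_cart_basis]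
      by (auto simp: inj_on_def)
    have "L.span (Pair 0 ` cart_basis) = Pair 0 ` vec.span (cart_basis :: ('k^'t) set)"
      by (rule Q.linear_span_image[OF linS])
    then have "L.span (Pair 0 ` cart_basis) = ?Z" by (simp add: Z span_cart_basis)
    with b have "L.dim ?Z = card (Pair 0 ` cart_basis :: ('k, 'n, 't) L_space set)"
      by (metis L.dim_span_eq_card_independent L.dim_span)
    then show ?thesis
      by (simp add: card_image inj_on_def card_cart_basis)
  qed
  have codim: "has_codim L_scale ?Z CARD('n)"
  proof -
    let ?B = "(\<lambda>x. (x, 0)) ` cart_basis :: ('k, 'n, 't) L_space set"
    have b: "L.independent ?B"
      using R.linear_independent_injective_image[OF linV independent_cart_basis]
      by (auto simp: inj_on_def)
    have sp: "L.span ?B = (\<lambda>x. (x, 0)) ` UNIV"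
      using R.linear_span_image[OF linV, of cart_basis] by (simp add: span_cart_basis)
    have c: "card ?B = CARD('n)" "finite ?B"
      by (auto simp: card_image inj_on_def card_cart_basis finite_cart_basis)
    have "u \<in> L.span (?B \<union> ?Z)" for u
    proof -
      have "(fst u, 0) \<in> L.span (?B \<union> ?Z)"
        using sp L.span_mono[of ?B "?B \<union> ?Z"] by auto
      moreover have "(0, snd u) \<in> L.span (?B \<union> ?Z)" by (rule L.span_base) auto
      ultimately have "(fst u, 0) + (0, snd u) \<in> L.span (?B \<union> ?Z)" by (rule L.span_add)
      then show ?thesis by simp
    qed
    then show ?thesis unfolding has_codim_def
      using b c sp by (intro exI[of _ ?B]) (auto simp: zero_prod_def)
  qed
  have "(0, axis undefined 1) \<in> ?Z" "(0 :: 'k^'n, axis undefined (1 :: 'k) :: 'k^'t) \<noteq> 0"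
    by (auto simp: zero_prod_def axis_eq_0_iff)
  then have "?Z \<noteq> {0}" by blast
  then show ?thesis
    unfolding two_step_nilpotent_type_def L_derived[OF indep]
    using L_lie_algebra[OF alt] dimZ codim
    by (auto simp: L_bracket_snd bil zero_prod_def vec_eq_iff)
qed

end

theory Submission
  imports Defs
begin

text \<open>The center of \<open>L(\<Phi>)\<close> is the sum of \<open>S\<close> and the common radical of the forms, and \<open>S\<close> is the
  derived algebra. The common radical vanishes as soon as a suitable \<open>n \<times> n\<close> minor of the stacked
  Gram matrices does not; for \<open>t = 1\<close> and odd \<open>n\<close>, where the radical is never zero, an
  \<open>(n - 1) \<times> (n - 1)\<close> minor bounds its dimension by 1. It remains to find one linearly independent
  tuple with nonzero minor. A perfect matching gives a form of rank \<open>n\<close>; for odd \<open>n\<close> and \<open>t \<ge> 2\<close>,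
  the vertex left out by a maximal matching is covered by a second form.\<close>

section \<open>Alternating matrices of odd size\<close>

text \<open>An injection into the naturals serves as a linear order: \<open>f\<close> exchanges the
  points it raises with the points it lowers, and without fixed points these two sets exhaust
  \<open>A\<close>.\<close>

lemma fixpoint_free_involution_imp_even_card:
  assumes "finite A" and "\<And>x. x \<in> A \<Longrightarrow> f x \<in> A \<and> f (f x) = x \<and> f x \<noteq> x"
  shows "even (card A)"
proof -
  obtain e :: "'a \<Rightarrow> nat" where e: "inj_on e A"
    using assms(1) finite_imp_inj_to_nat_seg by blast
  let ?L = "{x \<in> A. e x < e (f x)}" and ?G = "{x \<in> A. e (f x) < e x}"
  have "A = ?L \<union> ?G"
    using assms(2) e by (auto simp: inj_on_def) (metis nat_neq_iff)
  moreover have "bij_betw f ?L ?G"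
    by (rule bij_betw_byWitness[where f' = f]) (use assms(2) in auto)
  ultimately have "card A = card ?L + card ?G" "card ?L = card ?G"
    using assms(1) card_Un_disjoint[of ?L ?G] bij_betw_same_card by fastforce+
  then show ?thesis by simp
qed

text \<open>Two-element orbits cancel. Fixed points need the separate condition \<open>fix0\<close>,
  since \<open>g x = - g x\<close> does not force \<open>g x = 0\<close> in characteristic
  2.\<close>

lemma sum_eq_0_by_involution:
  fixes g :: "'a \<Rightarrow> 'b::comm_ring_1"
  assumes "finite A" and inv: "\<And>x. x \<in> A \<Longrightarrow> f x \<in> A \<and> f (f x) = x"
    and "\<And>x. x \<in> A \<Longrightarrow> g (f x) = - g x" and fix0: "\<And>x. x \<in> A \<Longrightarrow> f x = x \<Longrightarrow> g x = 0"
  shows "sum g A = 0"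
proof -
  have "sum g A = (\<Sum>x | x \<in> A \<and> f x \<noteq> x. g x)"
    by (rule sum.mono_neutral_right) (use assms(1) fix0 in auto)
  also have "\<dots> = 0"
    by (rule sum_involution_eq_0[where h = f]) (use inv assms(3) in auto)
  finally show ?thesis .
qed

text \<open>In characteristic 2, \<open>det A = - det A\<close> is no information; the terms of the Leibniz
  formula are instead cancelled in pairs, for a permutation and its inverse.\<close>

lemma det_alternating_odd:
  fixes A :: "'k::field^'n^'n"
  assumes skew: "\<And>i j. A $ i $ j = - A $ j $ i" and diag: "\<And>i. A $ i $ i = 0"
    and "odd CARD('n::finite)"
  shows "det A = 0"
  unfolding det_def
proof (rule sum_eq_0_by_involution[where f = inv])
  show "finite {p. p permutes (UNIV :: 'n set)}" by simp
next
  fix p assume "p \<in> {p. p permutes (UNIV :: 'n set)}"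
  then have p: "p permutes UNIV" by simp
  then show "inv p \<in> {p. p permutes UNIV} \<and> inv (inv p) = p"
    by (simp add: permutes_inv permutes_inv_inv)
  \<comment> \<open>Reindexing by \<open>p\<close> turns every factor into a transposed entry of the
    term for \<open>p\<close>; skewness then gives one sign per row, and the number of rows is
    odd.\<close>
  have "(\<Prod>i\<in>UNIV. A $ i $ inv p i) = (\<Prod>i\<in>UNIV. A $ p i $ inv p (p i))"
    by (subst prod.permute[OF p]) (simp add: o_def)
  also have "\<dots> = (\<Prod>i\<in>UNIV. - A $ i $ p i)"
    by (intro prod.cong refl) (simp add: permutes_inverses[OF p] skew[symmetric])
  also have "\<dots> = - (\<Prod>i\<in>UNIV. A $ i $ p i)"
    using assms(3) by (simp add: prod_uminus)
  finally show "of_int (sign (inv p)) * (\<Prod>i\<in>UNIV. A $ i $ inv p i) =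
      - (of_int (sign p) * (\<Prod>i\<in>UNIV. A $ i $ p i))"
    using p by simp (metis finite permutation_permutes sign_inverse)
  \<comment> \<open>A self-inverse permutation of an odd set has a fixed point, so its term contains
    a diagonal entry.\<close>
  show "of_int (sign p) * (\<Prod>i\<in>UNIV. A $ i $ p i) = 0" if "inv p = p"
  proof -
    have "p (p i) = i" for i using that permutes_inverses[OF p] by metis
    then obtain i where "p i = i"
      using assms(3) fixpoint_free_involution_imp_even_card[of "UNIV :: 'n set" p] by auto
    then show ?thesis using diag by (metis finite UNIV_I mult_zero_right prod_zero)
  qed
qed


section \<open>The common radical\<close>

definition common_radical :: "('k::field, 'n::finite, 't::finite) form_tuple \<Rightarrow> ('k^'n) set" where
  "common_radical \<Phi> = {x. \<forall>k y. \<Phi> k x y = 0}"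

lemma lie_center_L_bracket: "lie_center (L_bracket \<Phi>) = common_radical \<Phi> \<times> UNIV"
  by (auto simp: lie_center_def common_radical_def L_bracket_snd zero_prod_def vec_eq_iff)

lemma alternating_form_expand_left:
  assumes "\<phi> \<in> alternating_forms"
  shows "\<phi> x y = (\<Sum>l\<in>UNIV. x $ l * \<phi> (axis l 1) y)"
proof -
  note * = alternating_formsD[OF assms]
  have "\<phi> (\<Sum>l\<in>S. x $ l *s axis l 1) y = (\<Sum>l\<in>S. x $ l * \<phi> (axis l 1) y)" if "finite S" for S
    using that by induction (auto simp: *)
  from this[of UNIV] show ?thesis by (simp add: basis_expansion)
qed

lemma alternating_form_skew:
  assumes "\<phi> \<in> alternating_forms"
  shows "\<phi> x y = - \<phi> y x"
proof -
  note * = alternating_formsD[OF assms]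
  have "\<phi> x y + \<phi> y x = \<phi> (x + y) (x + y)" by (simp only: *(1,2)) (simp add: *(5))
  then show ?thesis by (simp add: *(5) eq_neg_iff_add_eq_0)
qed

lemma alternating_form_eq_0I:
  assumes "\<phi> \<in> alternating_forms" and "\<And>i. \<phi> x (axis i 1) = 0"
  shows "\<phi> x y = 0"
proof -
  have "\<phi> y x = 0"
    using assms(2)
    by (subst alternating_form_expand_left[OF assms(1)])
      (simp add: alternating_form_skew[OF assms(1), of "axis _ _"])
  then show ?thesis by (simp add: alternating_form_skew[OF assms(1), of x])
qed

text \<open>With a single form the common radical is the kernel of its Gram matrix, which is
  singular in odd size.\<close>

lemma common_radical_nontrivial:
  fixes \<Phi> :: "('k::field, 'n::finite, 't::finite) form_tuple"
  assumes "\<Phi> \<in> alternating_tuples" and "CARD('t) = 1" and "odd CARD('n)"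
  obtains v where "v \<in> common_radical \<Phi>" "v \<noteq> 0"
proof -
  obtain k where k: "(UNIV :: 't set) = {k}"
    using assms(2) card_1_singletonE by blast
  have alt: "\<Phi> k \<in> alternating_forms" using assms(1) by (simp add: alternating_tuples_def)
  \<comment> \<open>The indices are transposed so that \<open>A *v v\<close> lists the values of the
    form at \<open>v\<close> and the basis vectors.\<close>
  define A :: "'k^'n^'n" where "A = (\<chi> i l. \<Phi> k (axis l 1) (axis i 1))"
  have "det A = 0"
    by (rule det_alternating_odd)
      (use assms(3) in \<open>auto simp: A_def alternating_formsD[OF alt] intro: alternating_form_skew[OF alt]\<close>)
  then obtain v where v: "v \<noteq> 0" "A *v v = 0"
    by (metis invertible_det_nz invertible_left_inverse matrix_left_invertible_ker)
  have "\<Phi> k v (axis i 1) = (A *v v) $ i" for i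
    by (subst alternating_form_expand_left[OF alt])
      (simp add: A_def matrix_vector_mult_def mult.commute)
  then have "\<Phi> k v y = 0" for y
    using v(2) alternating_form_eq_0I[OF alt] by simp
  moreover have "k' = k" for k' using k by blast
  ultimately have "v \<in> common_radical \<Phi>" by (auto simp: common_radical_def) metis
  with v(1) that show thesis by blast
qed

text \<open>By \<open>r\<close>, coordinate \<open>r\<close> is injective on the common radical, so
  the radical is at most a line; in odd dimension it is also nonzero. The second dimension of the
  center is that of the derived algebra.\<close>

lemma dim_center_eq_2:
  fixes \<Phi> :: "('k::field, 'n::finite, 't::finite) form_tuple"
  assumes alt: "\<Phi> \<in> alternating_tuples" and t: "CARD('t) = 1" and "odd CARD('n)"
    and r: "\<And>x. x \<in> common_radical \<Phi> \<Longrightarrow> x $ r = 0 \<Longrightarrow> x = 0"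
  shows "vector_space.dim L_scale (lie_center (L_bracket \<Phi>)) = 2"
proof -
  interpret L: vector_space "L_scale :: 'k \<Rightarrow> ('k, 'n, 't) L_space \<Rightarrow> _" by (rule L_scale_vector_space)
  obtain v where v: "v \<in> common_radical \<Phi>" "v \<noteq> 0"
    using common_radical_nontrivial assms by blast
  have altk: "\<Phi> k \<in> alternating_forms" for k using alt by (simp add: alternating_tuples_def)
  note * = alternating_formsD[OF altk]
  have vr: "v $ r \<noteq> 0" using r v by blast
  have rad: "\<exists>c. x = c *s v" if "x \<in> common_radical \<Phi>" for x
  proof -
    \<comment> \<open>The multiple of \<open>v\<close> is chosen to cancel coordinate
      \<open>r\<close> of \<open>x\<close>.\<close>
    have "x + (- (x $ r / v $ r)) *s v \<in> common_radical \<Phi>"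
      using that v(1) unfolding common_radical_def mem_Collect_eq *(1,3) by simp
    then have "x + (- (x $ r / v $ r)) *s v = 0" by (rule r) (simp add: vr)
    then show ?thesis by auto
  qed
  obtain k where k: "(UNIV :: 't set) = {k}"
    using t card_1_singletonE by blast
  have all_k: "k' = k" for k' using k by blast
  let ?B = "{(v, 0), (0, axis k 1)} :: ('k, 'n, 't) L_space set"
  have ind: "L.independent ?B"
    using v(2) by (auto simp: L.independent_insert L.span_singleton L_scale_def axis_eq_0_iff zero_prod_def)
  have "L.span ?B = lie_center (L_bracket \<Phi>)"
  proof
    show "L.span ?B \<subseteq> lie_center (L_bracket \<Phi>)"
      unfolding lie_center_L_bracket using v(1)
      by (auto simp: L.span_insert L.span_singleton L_scale_def common_radical_def *)
    show "lie_center (L_bracket \<Phi>) \<subseteq> L.span ?B"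
      unfolding lie_center_L_bracket
    proof clarify
      fix x and y :: "'k^'t" assume "x \<in> common_radical \<Phi>"
      then obtain c where "x = c *s v" using rad by blast
      then have "(x, y) = L_scale c (v, 0) + L_scale (y $ k) (0, axis k 1)"
        using all_k by (auto simp: L_scale_def vec_eq_iff axis_def) metis
      then show "(x, y) \<in> L.span ?B"
        by (simp only:) (intro L.span_add L.span_scale L.span_base; simp)
    qed
  qed
  then have "L.dim (lie_center (L_bracket \<Phi>)) = card ?B"
    using ind by (metis L.dim_eq_card L.span_span)
  also have "card ?B = 2" using v(2) by simp
  finally show ?thesis .
qed


section \<open>Determinantal closed sets\<close>

text \<open>A unit row in place of a row of a Gram matrix turns the determinant into a smaller minor, with
  no need for a matrix type of smaller dimension.\<close>

definition gram_matrix ::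
  "('n \<Rightarrow> ('t \<times> 'n) option) \<Rightarrow> ('k::field, 'n::finite, 't::finite) form_tuple \<Rightarrow> 'k^'n^'n" where
  "gram_matrix \<sigma> \<Phi> = (\<chi> j l. case \<sigma> j of None \<Rightarrow> if l = j then 1 else 0
     | Some (k, i) \<Rightarrow> \<Phi> k (axis l 1) (axis i 1))"

lemma gram_matrix_mult_nth:
  assumes "\<Phi> \<in> alternating_tuples"
  shows "(gram_matrix \<sigma> \<Phi> *v x) $ j =
    (case \<sigma> j of None \<Rightarrow> x $ j | Some (k, i) \<Rightarrow> \<Phi> k x (axis i 1))"
proof (cases "\<sigma> j")
  case None
  then show ?thesis
    by (simp add: gram_matrix_def matrix_vector_mult_def if_distrib[of "\<lambda>c. c * _"] cong: if_cong)
next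
  case (Some ki)
  obtain k i where [simp]: "ki = (k, i)" by (cases ki)
  have "\<Phi> k \<in> alternating_forms" using assms by (simp add: alternating_tuples_def)
  from alternating_form_expand_left[OF this, of x] Some show ?thesis
    by (simp add: gram_matrix_def matrix_vector_mult_def mult.commute)
qed

text \<open>Replaces determinant computations by kernel arguments, both for the witness and for a
  general tuple: a square matrix is invertible exactly when the linear conditions given by its rows
  have only the trivial solution.\<close>

lemma det_gram_matrix_nz_iff:
  assumes "\<Phi> \<in> alternating_tuples"
  shows "det (gram_matrix \<sigma> \<Phi>) \<noteq> 0 \<longleftrightarrow>
    (\<forall>x. (\<forall>j. case \<sigma> j of None \<Rightarrow> x $ j = 0 | Some (k, i) \<Rightarrow> \<Phi> k x (axis i 1) = 0) \<longrightarrow> x = 0)"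
proof -
  have "gram_matrix \<sigma> \<Phi> *v x = 0 \<longleftrightarrow>
    (\<forall>j. case \<sigma> j of None \<Rightarrow> x $ j = 0 | Some (k, i) \<Rightarrow> \<Phi> k x (axis i 1) = 0)" for x
    unfolding vec_eq_iff gram_matrix_mult_nth[OF assms] by (auto split: option.splits)
  then show ?thesis
    using invertible_det_nz[of "gram_matrix \<sigma> \<Phi>"]
    by (simp add: invertible_left_inverse matrix_left_invertible_ker)
qed

lemma homogeneous_poly_fun_prod:
  assumes "finite S" and "\<And>i. i \<in> S \<Longrightarrow> homogeneous_poly_fun s W (d i) (f i)"
  shows "homogeneous_poly_fun s W (sum d S) (\<lambda>w. \<Prod>i\<in>S. f i w)"
  using assms
  by (induction S) (simp_all add: homogeneous_poly_fun.const homogeneous_poly_fun.mult)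

lemma homogeneous_poly_fun_sum:
  assumes "finite S" "S \<noteq> {}" and "\<And>i. i \<in> S \<Longrightarrow> homogeneous_poly_fun s W d (f i)"
  shows "homogeneous_poly_fun s W d (\<lambda>w. \<Sum>i\<in>S. f i w)"
  using assms by (induction S rule: finite_ne_induct) (simp_all add: homogeneous_poly_fun.add)

lemma homogeneous_poly_fun_cmult:
  assumes "homogeneous_poly_fun s W d f"
  shows "homogeneous_poly_fun s W d (\<lambda>w. c * f w)"
  using homogeneous_poly_fun.mult[OF homogeneous_poly_fun.const assms] by simp

text \<open>Each Leibniz term takes one entry from every row, so all terms have the same degree even
  if the rows have different degrees.\<close>

lemma homogeneous_poly_fun_det:
  fixes A :: "'w::ab_group_add \<Rightarrow> 'k::field^'n^'n"
  assumes "\<And>j l. homogeneous_poly_fun s W (d j) (\<lambda>w. A w $ j $ l)"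
  shows "homogeneous_poly_fun s W (\<Sum>j\<in>UNIV. d j) (\<lambda>w. det (A w))"
  unfolding det_def
  by (intro homogeneous_poly_fun_sum homogeneous_poly_fun_cmult homogeneous_poly_fun_prod assms)
    (auto intro: permutes_id)

text \<open>Unit rows are constant and the other rows are linear in the tuple, so the degree is the
  number of rows taken from Gram matrices.\<close>

lemma homogeneous_poly_fun_det_gram_matrix:
  "\<exists>d. homogeneous_poly_fun tuple_scale W d (\<lambda>\<Phi>. det (gram_matrix \<sigma> \<Phi>))"
proof -
  have "homogeneous_poly_fun tuple_scale W (if \<sigma> j = None then 0 else 1)
      (\<lambda>\<Phi>. gram_matrix \<sigma> \<Phi> $ j $ l)" for j l
    by (cases "\<sigma> j")
      (auto simp: gram_matrix_def linear_functional_on_def tuple_scale_def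
        intro: homogeneous_poly_fun.const homogeneous_poly_fun.linear[unfolded One_nat_def])
  from homogeneous_poly_fun_det[OF this] show ?thesis by (rule exI)
qed

section \<open>Genericity from one nonvanishing minor\<close>

lemma tuple_scale_vector_space:
  "vector_space (tuple_scale :: 'k::field \<Rightarrow> ('k, 'n::finite, 't::finite) form_tuple \<Rightarrow> _)"
  by unfold_locales (auto simp: tuple_scale_def fun_eq_iff algebra_simps)

lemma tuple_scale_in_alternating_tuples:
  assumes "\<Phi> \<in> alternating_tuples"
  shows "tuple_scale c \<Phi> \<in> alternating_tuples"
  using assms
  by (auto simp: tuple_scale_def alternating_tuples_def alternating_forms_def algebra_simps)

text \<open>The exceptional closed set is the zero locus of
  \<open>det (gram_matrix \<sigma> \<Phi>)\<close>; the line through \<open>\<Psi>\<close> shows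
  that it is proper. Off this locus a vector of the common radical satisfies all row conditions once
  its coordinates at the unit rows vanish, and is therefore zero.\<close>

lemma generic_two_stepI:
  fixes \<Psi> :: "('k::field, 'n::finite, 't::finite) form_tuple"
    and A :: "('k \<Rightarrow> ('k, 'n, 't) L_space \<Rightarrow> ('k, 'n, 't) L_space) \<Rightarrow>
    (('k, 'n, 't) L_space \<Rightarrow> ('k, 'n, 't) L_space \<Rightarrow> ('k, 'n, 't) L_space) \<Rightarrow> bool"
    and \<sigma> :: "'n \<Rightarrow> ('t \<times> 'n) option"
  assumes \<Psi>: "\<Psi> \<in> alternating_tuples" "lin_indep_tuple \<Psi>" "det (gram_matrix \<sigma> \<Psi>) \<noteq> 0"
    and A: "\<And>\<Phi>. \<Phi> \<in> alternating_tuples \<Longrightarrow> lin_indep_tuple \<Phi> \<Longrightarrow>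
      (\<And>x. x \<in> common_radical \<Phi> \<Longrightarrow> (\<And>j. \<sigma> j = None \<Longrightarrow> x $ j = 0) \<Longrightarrow> x = 0) \<Longrightarrow>
      A L_scale (L_bracket \<Phi>)"
  shows "generic_two_step A"
proof -
  interpret T: vector_space "tuple_scale :: 'k \<Rightarrow> ('k, 'n, 't) form_tuple \<Rightarrow> _"
    by (rule tuple_scale_vector_space)
  let ?f = "\<lambda>\<Phi> :: ('k, 'n, 't) form_tuple. det (gram_matrix \<sigma> \<Phi>)"
  let ?C = "{p \<in> proj_space tuple_scale alternating_tuples. \<forall>f\<in>{?f}. \<forall>w\<in>p. f w = 0}"
  let ?p = "T.span {\<Psi>}"
  have "zariski_closed tuple_scale alternating_tuples ?C"
    unfolding zariski_closed_def
    by (intro exI[of _ "{?f}"] conjI refl) (simp add: homogeneous_poly_fun_det_gram_matrix)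
  then have closed: "zariski_closed_in tuple_scale alternating_tuples M_points (M_points \<inter> ?C)"
    unfolding zariski_closed_in_def by blast
  have witness: "?p \<in> M_points" "?p \<notin> ?C"
  proof -
    have "\<Psi> \<noteq> 0"
    proof
      assume "\<Psi> = 0"
      then show False using \<Psi>(2) unfolding lin_indep_tuple_def
        by (elim allE[of _ "\<lambda>_. 1"]) simp
    qed
    \<comment> \<open>Points are lines, and \<open>M_points\<close> asks for independence of every
      nonzero representative.\<close>
    moreover have "lin_indep_tuple (tuple_scale c \<Psi>)" if "tuple_scale c \<Psi> \<noteq> 0" for c
    proof -
      have "c \<noteq> 0" using that by auto
      have "(\<Sum>i\<in>UNIV. a i * (c * \<Psi> i x y)) = c * (\<Sum>i\<in>UNIV. a i * \<Psi> i x y)" for a x y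
        by (simp add: sum_distrib_left mult.left_commute)
      then show ?thesis
        using \<Psi>(2) \<open>c \<noteq> 0\<close> by (simp add: lin_indep_tuple_def tuple_scale_def)
    qed
    ultimately show "?p \<in> M_points"
      using \<Psi>(1) by (auto simp: M_points_def proj_space_def T.span_singleton)
    show "?p \<notin> ?C" using \<Psi>(3) T.span_base[of \<Psi> "{\<Psi>}"] by auto
  qed
  have bad: "p \<in> ?C" if p: "p \<in> M_points" and \<Phi>: "\<Phi> \<in> p - {0}" "\<not> A L_scale (L_bracket \<Phi>)" for p \<Phi>
  proof -
    obtain u where u: "u \<in> alternating_tuples" "p = T.span {u}"
      using p by (auto simp: M_points_def proj_space_def)
    have alt: "w \<in> alternating_tuples" if "w \<in> p" for w
      using that u tuple_scale_in_alternating_tuples by (auto simp: T.span_singleton)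
    have "?f w = 0" if w: "w \<in> p" for w
    proof (rule ccontr)
      assume f: "?f w \<noteq> 0"
      \<comment> \<open>The minor is nonzero at \<open>w\<close>, while \<open>A\<close> fails at
        \<open>\<Phi>\<close>. Both lie on one line, so \<open>w\<close> is a multiple of
        \<open>\<Phi>\<close> and vanishes on the common radical of \<open>\<Phi>\<close>.\<close>
      obtain a b where a: "\<Phi> = tuple_scale a u" and b: "w = tuple_scale b u"
        using u(2) w \<Phi>(1) by (auto simp: T.span_singleton)
      have "a \<noteq> 0" using a \<Phi>(1) by auto
      then have w': "w = tuple_scale (b / a) \<Phi>" using a b by simp
      have "A L_scale (L_bracket \<Phi>)"
      proof (rule A)
        show "\<Phi> \<in> alternating_tuples" using alt \<Phi>(1) by blast
        show "lin_indep_tuple \<Phi>" using p \<Phi>(1) by (auto simp: M_points_def)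
        fix x assume "x \<in> common_radical \<Phi>" and "\<And>j. \<sigma> j = None \<Longrightarrow> x $ j = 0"
        then have "\<forall>j. case \<sigma> j of None \<Rightarrow> x $ j = 0 | Some (k, i) \<Rightarrow> w k x (axis i 1) = 0"
          by (auto simp: w' common_radical_def tuple_scale_def split: option.splits)
        then show "x = 0" using f det_gram_matrix_nz_iff[OF alt[OF w]] by blast
      qed
      then show False using \<Phi>(2) by blast
    qed
    then show ?thesis using p by (auto simp: M_points_def)
  qed
  show ?thesis
    unfolding generic_two_step_def
  proof (rule exI[of _ "M_points \<inter> ?C"], intro conjI)
    show "zariski_closed_in tuple_scale alternating_tuples M_points (M_points \<inter> ?C)" by (rule closed)
    show "M_points \<inter> ?C \<noteq> M_points"
    proof
      assume "M_points \<inter> ?C = M_points"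
      from equalityD2[OF this] have "?p \<in> M_points \<inter> ?C" by (rule subsetD) (rule witness)
      then show False using witness(2) by (elim IntE notE)
    qed
    show "{p \<in> M_points. \<exists>\<Phi>\<in>p - {0}. \<not> A L_scale (L_bracket \<Phi>)} \<subseteq> M_points \<inter> ?C"
    proof
      fix p assume "p \<in> {p \<in> M_points. \<exists>\<Phi>\<in>p - {0}. \<not> A L_scale (L_bracket \<Phi>)}"
      then obtain \<Phi> where p: "p \<in> M_points" and \<Phi>: "\<Phi> \<in> p - {0}" "\<not> A L_scale (L_bracket \<Phi>)"
        by (elim CollectE conjE bexE)
      show "p \<in> M_points \<inter> ?C" by (rule IntI[OF p bad[OF p \<Phi>]])
    qed
  qed
qed


section \<open>A regular tuple\<close>

definition wedge :: "'n \<Rightarrow> 'n \<Rightarrow> ('k::field, 'n::finite) form" where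
  "wedge a b x y = x $ a * y $ b - x $ b * y $ a"

lemma wedge_alternating: "wedge a b \<in> alternating_forms"
  by (auto simp: alternating_forms_def wedge_def algebra_simps)

lemma sum_wedge_alternating:
  "(\<lambda>x y. \<Sum>(a, b)\<in>P. wedge a b x y) \<in> alternating_forms"
  by (simp add: alternating_forms_def alternating_formsD[OF wedge_alternating]
      case_prod_unfold sum.distrib sum_distrib_left)

text \<open>All pairs split into increasing, decreasing and diagonal ones. The count shows that the
  upper bound on \<open>t\<close> leaves enough distinct wedges for a tuple.\<close>

lemma card_less_pairs:
  fixes e :: "'n::finite \<Rightarrow> nat"
  assumes "inj e"
  shows "card {(a, b). e a < e b} = CARD('n) * (CARD('n) - 1) div 2"
proof -
  let ?E = "{(a, b). e a < e b}"
  have "(UNIV :: ('n \<times> 'n) set) = ?E \<union> prod.swap ` ?E \<union> range (\<lambda>a. (a, a))"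
    using assms by (auto simp: inj_def image_iff)
  then have "CARD('n \<times> 'n) = card (?E \<union> prod.swap ` ?E \<union> range (\<lambda>a. (a, a)))" by simp
  also have "\<dots> = card (?E \<union> prod.swap ` ?E) + card (range (\<lambda>a :: 'n. (a, a)))"
    by (rule card_Un_disjoint) auto
  also have "card (?E \<union> prod.swap ` ?E) = card ?E + card (prod.swap ` ?E)"
    by (rule card_Un_disjoint) auto
  also have "card (prod.swap ` ?E) = card ?E" by (simp add: card_image)
  also have "card (range (\<lambda>a :: 'n. (a, a))) = CARD('n)" by (simp add: card_image inj_on_def)
  finally have "CARD('n) * CARD('n) = 2 * card ?E + CARD('n)" by simp
  then show ?thesis by (simp add: right_diff_distrib')
qed

text \<open>If \<open>p k1\<close> belongs to the matching \<open>M\<close>, the tuple is triangular with respect to the linearly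
  independent wedges given by \<open>p\<close>, hence independent itself.\<close>

definition matching_tuple ::
  "('t \<Rightarrow> 'n \<times> 'n) \<Rightarrow> 't \<Rightarrow> ('n \<times> 'n) set \<Rightarrow> ('k::field, 'n::finite, 't::finite) form_tuple" where
  "matching_tuple p k1 M = (\<lambda>k x y. \<Sum>(a, b)\<in>(if k = k1 then M else {p k}). wedge a b x y)"

lemma matching_tuple_alternating: "matching_tuple p k1 M \<in> alternating_tuples"
  unfolding alternating_tuples_def matching_tuple_def using sum_wedge_alternating by blast

text \<open>The value -1 could only come from the reversed pair \<open>(j, i)\<close>, which the
  first assumption keeps out of \<open>P\<close>.\<close>

lemma sum_wedge_axis:
  assumes "\<And>a b. (a, b) \<in> P \<Longrightarrow> (b, a) \<notin> P'" and "(i, j) \<in> P'"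
  shows "(\<Sum>(a, b)\<in>P. wedge a b (axis i 1) (axis j 1)) = (if (i, j) \<in> P then 1 else 0 :: 'k::field)"
proof -
  have "(\<Sum>(a, b)\<in>P. wedge a b (axis i 1) (axis j 1)) = (\<Sum>q\<in>P. if q = (i, j) then 1 else 0 :: 'k)"
    by (rule sum.cong) (use assms in \<open>auto simp: wedge_def axis_def split: if_splits\<close>)
  also have "\<dots> = (if (i, j) \<in> P then 1 else 0)" by simp
  finally show ?thesis .
qed

lemma matching_tuple_lin_indep:
  fixes p :: "'t::finite \<Rightarrow> 'n::finite \<times> 'n" and e :: "'n \<Rightarrow> nat"
  assumes "inj p" and pM: "p k1 \<in> M"
    and E: "range p \<subseteq> {(a, b). e a < e b}" "M \<subseteq> {(a, b). e a < e b}"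
  shows "lin_indep_tuple (matching_tuple p k1 M :: ('k::field, 'n, 't) form_tuple)"
  unfolding lin_indep_tuple_def
proof (intro allI impI)
  let ?P = "\<lambda>k. if k = k1 then M else {p k}"
  fix c :: "'t \<Rightarrow> 'k" and k
  assume 0: "\<forall>x y. (\<Sum>i\<in>UNIV. c i * matching_tuple p k1 M i x y) = 0"
  \<comment> \<open>Evaluating the relation at the two basis vectors of \<open>p k\<close> extracts
    the coefficient of that wedge.\<close>
  have *: "(\<Sum>i\<in>UNIV. if p k \<in> ?P i then c i else 0) = 0" for k
  proof -
    obtain a b where ab: "p k = (a, b)" by fastforce
    have pE: "p i \<in> {(a, b). e a < e b}" for i by (rule subsetD[OF E(1) rangeI])
    then have P: "?P i \<subseteq> {(a, b). e a < e b}" for i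
      using E(2) by (cases "i = k1") (simp_all only: if_True if_False insert_subset empty_subsetI simp_thms)
    have ab_E: "(a, b) \<in> {(a, b). e a < e b}" using pE[of k] by (simp only: ab)
    have asym: "(b, a) \<notin> {(a, b). e a < e b}" if "(a, b) \<in> ?P i" for a b i
      using subsetD[OF P that] by simp
    have "matching_tuple p k1 M i (axis a 1) (axis b 1) = (if p k \<in> ?P i then 1 else 0 :: 'k)" for i
      unfolding matching_tuple_def ab by (rule sum_wedge_axis[OF asym ab_E])
    then show ?thesis
      using 0[rule_format, of "axis a 1" "axis b 1"]
      by (simp add: if_distrib[of "\<lambda>z. _ * z"] cong: if_cong)
  qed
  \<comment> \<open>The wedge \<open>p k1\<close> occurs in form \<open>k1\<close> only. Any other
    \<open>p k\<close> may occur in \<open>M\<close> as well, but that contribution disappears once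
    \<open>c k1 = 0\<close>.\<close>
  have "(if p k1 \<in> ?P i then c i else 0) = (if i = k1 then c i else 0)" for i
    using pM \<open>inj p\<close> by (auto simp: inj_eq)
  then have k1: "c k1 = 0" using *[of k1] by simp
  have "(if p k \<in> ?P i then c i else 0) = (if i = k then c i else 0)" for i
    using pM \<open>inj p\<close> k1 by (auto simp: inj_eq)
  then show "c k = 0" using *[of k] by simp
qed

text \<open>\<open>M\<close> joins the positions 0-1, 2-3, and so on, so each vertex lies in at most
  one pair and only the wedge of \<open>(i, m)\<close> contributes.\<close>

lemma sum_wedge_matching:
  fixes e :: "'n::finite \<Rightarrow> nat" and x :: "'k::field^'n"
  defines "M \<equiv> {(a, b). even (e a) \<and> e b = Suc (e a)}"
  assumes "inj e" and "(i, m) \<in> M"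
  shows "(\<Sum>(a, b)\<in>M. wedge a b x (axis m 1)) = x $ i"
    and "(\<Sum>(a, b)\<in>M. wedge a b x (axis i 1)) = - x $ m"
proof -
  have *: "even (e i)" "e m = Suc (e i)" using assms(3) by (auto simp: M_def)
  have w: "wedge a b x (axis m 1) = (if (a, b) = (i, m) then x $ i else 0)"
    "wedge a b x (axis i 1) = (if (a, b) = (i, m) then - x $ m else 0)" if "(a, b) \<in> M" for a b
  proof -
    have ab: "even (e a)" "e b = Suc (e a)" using that by (auto simp: M_def)
    have "a \<noteq> m" "b \<noteq> i" using ab * by auto
    moreover have "a = i \<longleftrightarrow> b = m"
      using ab(2) *(2) inj_eq[OF \<open>inj e\<close>, of a i] inj_eq[OF \<open>inj e\<close>, of b m] by simp
    ultimately show "wedge a b x (axis m 1) = (if (a, b) = (i, m) then x $ i else 0)"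
      "wedge a b x (axis i 1) = (if (a, b) = (i, m) then - x $ m else 0)"
      by (auto simp: wedge_def axis_def)
  qed
  have "(\<Sum>(a, b)\<in>M. wedge a b x (axis m 1)) = (\<Sum>q\<in>M. if q = (i, m) then x $ i else 0)"
    by (rule sum.cong) (auto simp only: w split: prod.split)
  then show "(\<Sum>(a, b)\<in>M. wedge a b x (axis m 1)) = x $ i"
    using assms(3) by simp
  have "(\<Sum>(a, b)\<in>M. wedge a b x (axis i 1)) = (\<Sum>q\<in>M. if q = (i, m) then - x $ m else 0)"
    by (rule sum.cong) (auto simp only: w split: prod.split)
  then show "(\<Sum>(a, b)\<in>M. wedge a b x (axis i 1)) = - x $ m"
    using assms(3) by simp
qed

section \<open>The witness and the three cases\<close>

theorem theorem1:
  fixes n t :: nat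
  assumes "infinite (UNIV :: 'k::field set)"
    and "CARD('n::finite) = n" and "CARD('t::finite) = t"
    and "1 \<le> t" and "t \<le> n * (n - 1) div 2"
  shows "generic_two_step
    (\<lambda>(s :: 'k \<Rightarrow> ('k, 'n, 't) L_space \<Rightarrow> ('k, 'n, 't) L_space) br.
       if t = 1 \<and> odd n then vector_space.dim s (lie_center br) = 2
       else lie_center br = lie_derived s br)"
proof -
  let ?A = "\<lambda>(s :: 'k \<Rightarrow> ('k, 'n, 't) L_space \<Rightarrow> ('k, 'n, 't) L_space) br.
       if t = 1 \<and> odd n then vector_space.dim s (lie_center br) = 2
       else lie_center br = lie_derived s br"
  have n2: "n \<ge> 2"
  proof (rule ccontr)
    assume "\<not> 2 \<le> n"
    then have "n = 0 \<or> n = 1" by auto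
    then show False using assms(4,5) by auto
  qed
  obtain e :: "'n \<Rightarrow> nat" where e: "bij_betw e UNIV {0..<n}"
    using ex_bij_betw_finite_nat[of "UNIV :: 'n set"] assms(2) by auto
  then have inj_e: "inj e" and e_less: "e i < n" for i
    by (auto simp: bij_betw_def)
  define v where "v = the_inv_into UNIV e"
  have ev: "e (v i) = i" if "i < n" for i
    using e that by (simp add: v_def f_the_inv_into_f_bij_betw)
  have ve: "v (e a) = a" for a
    using inj_e by (simp add: v_def the_inv_f_f)
  \<comment> \<open>The last vertex: for odd \<open>n\<close> its position is even and has no
    successor, so it is the vertex missed by the matching.\<close>
  define z where "z = v (n - 1)"
  have ez: "e z = n - 1" using ev n2 by (simp add: z_def)
  have eq_z: "e i = n - 1 \<longleftrightarrow> i = z" for i using ez inj_e by (metis injD)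
  let ?E = "{(a, b). e a < e b}" and ?M = "{(a, b). even (e a) \<and> e b = Suc (e a)}"
  \<comment> \<open>\<open>?q1\<close> is the first edge of the matching and marks the form replaced
    by all of \<open>?M\<close>; \<open>?q2\<close> joins the missed vertex to vertex 0 and is
    requested only when there is room for a second form.\<close>
  let ?q1 = "(v 0, v 1)" and ?q2 = "(v 0, z)"
  have q1: "?q1 \<in> ?M" using ev n2 by simp
  have q2: "?q2 \<in> ?E" using ev ez n2 by simp
  let ?R = "if odd n \<and> t \<noteq> 1 then {?q1, ?q2} else {?q1}"
  have "\<exists>S. ?R \<subseteq> S \<and> S \<subseteq> ?E \<and> card S = t"
  proof (rule exists_subset_between)
    show "card ?R \<le> t" using assms(4) by (auto simp: card_insert_if)
    show "t \<le> card ?E" using assms(2,5) by (simp add: card_less_pairs[OF inj_e])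
    show "?R \<subseteq> ?E" using q1 q2 by auto
  qed simp
  then obtain S where S: "?R \<subseteq> S" "S \<subseteq> ?E" "card S = t" by blast
  obtain p where "bij_betw p (UNIV :: 't set) S"
    using S assms(3) finite_same_card_bij[of "UNIV :: 't set" S] by (auto intro: finite_subset)
  then have inj_p: "inj p" and range_p: "range p = S" by (auto simp: bij_betw_def)
  have "?q1 \<in> S" using S(1) by (auto split: if_splits)
  then obtain k1 where k1: "p k1 = ?q1" using range_p by (metis rangeE)
  let ?\<Psi> = "matching_tuple p k1 ?M :: ('k, 'n, 't) form_tuple"
  have indep: "lin_indep_tuple ?\<Psi>"
    by (rule matching_tuple_lin_indep[OF inj_p]) (use k1 q1 range_p S(2) in auto)
  \<comment> \<open>Testing form \<open>k1\<close> against the partner of a vertex returns that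
    coordinate up to sign. For odd \<open>n\<close> the unmatched coordinate \<open>x $ z\<close>
    has to be supplied separately.\<close>
  have ker: "x = 0"
    if x: "\<And>j. even n \<or> j \<noteq> z \<Longrightarrow> ?\<Psi> k1 x (axis j 1) = 0" and xz: "odd n \<Longrightarrow> x $ z = 0" for x
  proof -
    have "x $ i = 0" for i
    proof (cases "odd n \<and> i = z")
      case True
      then show ?thesis using xz by simp
    next
      case i: False
      show ?thesis
      proof (cases "even (e i)")
        case True
        \<comment> \<open>The last position is odd for even \<open>n\<close>, and is that of
          \<open>z\<close> for odd \<open>n\<close>; neither is possible here.\<close>
        have "Suc (e i) < n"
          using i e_less[of i] eq_z[of i] True n2
          by (metis Suc_lessI diff_Suc_1 even_Suc)
        then have im: "(i, v (Suc (e i))) \<in> ?M" using True ev by simp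
        moreover have "even n \<or> v (Suc (e i)) \<noteq> z"
        proof -
          have "odd (e (v (Suc (e i))))" using im True by simp
          moreover have "even n \<or> even (e z)" using ez n2 by simp
          ultimately show ?thesis by auto
        qed
        ultimately show ?thesis
          using x sum_wedge_matching(1)[OF inj_e im, of x] by (simp add: matching_tuple_def)
      next
        case False
        then obtain d where d: "e i = Suc d" "even d" by (cases "e i") auto
        have m: "e (v d) = d" using e_less[of i] d by (intro ev) simp
        then have im: "(v d, i) \<in> ?M" using d by simp
        moreover have "v d \<noteq> z" using m ez e_less[of i] d by fastforce
        ultimately show ?thesis
          using x sum_wedge_matching(2)[OF inj_e im, of x] by (simp add: matching_tuple_def)
      qed
    qed
    then show ?thesis by (simp add: vec_eq_iff)
  qed
  have center: "lie_center (L_bracket \<Phi>) = lie_derived L_scale (L_bracket \<Phi>)"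
    if "\<Phi> \<in> alternating_tuples" "lin_indep_tuple \<Phi>" "\<And>x. x \<in> common_radical \<Phi> \<Longrightarrow> x = 0"
    for \<Phi> :: "('k, 'n, 't) form_tuple"
  proof -
    have "0 \<in> common_radical \<Phi>"
      using that(1) by (simp add: common_radical_def alternating_tuples_def alternating_formsD)
    then have "common_radical \<Phi> = {0}" using that(3) by blast
    then show ?thesis by (simp add: lie_center_L_bracket L_derived[OF that(2)])
  qed
  have generic_center: "generic_two_step ?A"
    if "\<not> (t = 1 \<and> odd n)" "det (gram_matrix \<sigma> ?\<Psi>) \<noteq> 0" "\<And>j. \<sigma> j \<noteq> None" for \<sigma>
  proof (rule generic_two_stepI[OF matching_tuple_alternating indep that(2)])
    fix \<Phi> :: "('k, 'n, 't) form_tuple"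
    assume "\<Phi> \<in> alternating_tuples" "lin_indep_tuple \<Phi>"
      and *: "\<And>x. x \<in> common_radical \<Phi> \<Longrightarrow> (\<And>j. \<sigma> j = None \<Longrightarrow> x $ j = 0) \<Longrightarrow> x = 0"
    moreover have "x = 0" if "x \<in> common_radical \<Phi>" for x
      by (rule *[OF that]) (use \<open>\<And>j. \<sigma> j \<noteq> None\<close> in blast)
    ultimately have "lie_center (L_bracket \<Phi>) = lie_derived L_scale (L_bracket \<Phi>)"
      by (intro center)
    then show "?A L_scale (L_bracket \<Phi>)" unfolding if_not_P[OF \<open>\<not> (t = 1 \<and> odd n)\<close>] .
  qed
  note nz_iff = det_gram_matrix_nz_iff[OF matching_tuple_alternating]
  consider "even n" | "odd n" "t = 1" | "odd n" "t \<noteq> 1" by blast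
  then show ?thesis
  proof cases
    case 1
    let ?\<sigma> = "\<lambda>j. Some (k1, j)"
    have "det (gram_matrix ?\<sigma> ?\<Psi>) \<noteq> 0"
      unfolding nz_iff using ker 1 by simp
    then show ?thesis by (rule generic_center[rotated]) (use 1 in simp_all)
  next
    case 2
    \<comment> \<open>The unit row at \<open>z\<close> makes this an (n - 1)-minor, which confines
      the radical to at most a line detected by coordinate \<open>z\<close>.\<close>
    let ?\<sigma> = "\<lambda>j. if j = z then None else Some (k1, j)"
    have "det (gram_matrix ?\<sigma> ?\<Psi>) \<noteq> 0"
      unfolding nz_iff
    proof (intro allI impI)
      fix x
      assume x: "\<forall>j. case ?\<sigma> j of None \<Rightarrow> x $ j = 0 | Some (k, i) \<Rightarrow> ?\<Psi> k x (axis i 1) = 0"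
      have "x $ z = 0" using x[rule_format, of z] by simp
      moreover have "?\<Psi> k1 x (axis j 1) = 0" if "j \<noteq> z" for j using x[rule_format, of j] that by simp
      ultimately show "x = 0" using ker 2 by blast
    qed
    then show ?thesis
    proof (rule generic_two_stepI[OF matching_tuple_alternating indep])
      fix \<Phi> :: "('k, 'n, 't) form_tuple"
      assume "\<Phi> \<in> alternating_tuples"
        and *: "\<And>x. x \<in> common_radical \<Phi> \<Longrightarrow> (\<And>j. ?\<sigma> j = None \<Longrightarrow> x $ j = 0) \<Longrightarrow> x = 0"
      moreover have "x = 0" if "x \<in> common_radical \<Phi>" "x $ z = 0" for x
        by (rule *[OF that(1)]) (use that(2) in \<open>simp split: if_splits\<close>)
      ultimately have "vector_space.dim L_scale (lie_center (L_bracket \<Phi>)) = 2"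
        using assms(2,3) 2 by (intro dim_center_eq_2) simp_all
      then show "?A L_scale (L_bracket \<Phi>)" using 2 by simp
    qed
  next
    case 3
    then have "?q2 \<in> S" using S(1) by auto
    then obtain k2 where k2: "p k2 = ?q2" using range_p by (metis rangeE)
    \<comment> \<open>For odd \<open>n\<close> at least 3 the vertex \<open>z\<close> differs from
      vertices 0 and 1, so the two edges belong to different forms.\<close>
    have "n \<noteq> 2" using 3 by auto
    then have "e (v 1) \<noteq> e z" "e (v 0) \<noteq> e z"
      unfolding ez using ev[of 1] ev[of 0] n2 by simp_all
    then have "v 1 \<noteq> z" and "v 0 \<noteq> z" by metis+
    then have k12: "k2 \<noteq> k1" using k1 k2 by fastforce
    \<comment> \<open>Row \<open>z\<close> tests the second form against vertex 0, where the wedge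
      \<open>?q2\<close> yields \<open>- x $ z\<close>, the coordinate missing from the
      matching.\<close>
    let ?\<sigma> = "\<lambda>j. if j = z then Some (k2, v 0) else Some (k1, j)"
    have "det (gram_matrix ?\<sigma> ?\<Psi>) \<noteq> 0"
      unfolding nz_iff
    proof (intro allI impI)
      fix x
      assume x: "\<forall>j. case ?\<sigma> j of None \<Rightarrow> x $ j = 0 | Some (k, i) \<Rightarrow> ?\<Psi> k x (axis i 1) = 0"
      have "?\<Psi> k2 x (axis (v 0) 1) = 0" using x[rule_format, of z] by simp
      then have "x $ z = 0"
        using k12 k2 \<open>v 0 \<noteq> z\<close> by (simp add: matching_tuple_def wedge_def axis_def)
      moreover have "?\<Psi> k1 x (axis j 1) = 0" if "j \<noteq> z" for j using x[rule_format, of j] that by simp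
      ultimately show "x = 0" using ker 3 by blast
    qed
    then show ?thesis by (rule generic_center[rotated]) (use 3 in simp_all)
  qed
qed

end
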